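(* Let $p$ be an $E$-distance on a separated uniform space $X$ such that $X$ is $p$-complete, and let $T:X\to X$ satisfy $$p(Tx,Ty)\le\psi\big(p(x,y)\big)\quad\text{for all }x,y\in X,$$ where $\psi\in\Psi$. Then $T$ has a unique fixed point $u\in X$, and $T^nx\stackrel{p}{\longrightarrow}u$ for all $x\in X$.
   Context: A uniform space is a nonempty set $X$ with a uniformity $\mathscr U$ (a collection of entourages, subsets of $X\times X$, in the usual sense). It is separated if the intersection of all entourages is the diagonal $\{(x,x):x\in X\}$. An $E$-distance on a uniform space $X$ is a function $p:X\times X\to[0,\infty)$ such that (i) for each entourage $U$ there exists $\delta>0$ such that, for all $x,y,z\in X$, $p(z,x)\le\delta$ and $p(z,y)\le\delta$ imply $(x,y)\in U$; and (ii) $p(x,y)\le p(x,z)+p(z,y)$ for all $x,y,z\in X$. (No symmetry is assumed, nor $p(x,x)=0$.) A sequence $\{x_n\}$ in $X$ is $p$-convergent to $x\in X$, written $x_n\stackrel{p}{\longrightarrow}x$, if $p(x_n,x)\to0$ as $n\to\infty$; it is $p$-Cauchy if $p(x_m,x_n)\to0$ as $m,n\to\infty$. $X$ is $p$-complete if every $p$-Cauchy sequence in $X$ is $p$-convergent to some point of $X$. $\Psi$ is the class of all functions $\psi:[0,\infty)\to[0,\infty)$ such that (a) $\psi$ is upper semicontinuous from the right, i.e. $t_n\downarrow t\ge0$ implies $\limsup_{n\to\infty}\psi(t_n)\le\psi(t)$; and (b) $\psi(t)<t$ for all $t>0$, and $\psi(0)=0$. $T^n$ denotes the $n$-th iterate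 of $T$. *)

theory Defs
  imports Complex_Main "HOL-Library.Extended_Real"
begin

(* The uniform space X is a type of class uniform_space; its topology is the one
   induced by the uniformity, so the class carries no further data. *)

definition entourage :: "('a::uniform_space \<times> 'a) set \<Rightarrow> bool"
  where "entourage U \<longleftrightarrow> eventually (\<lambda>z. z \<in> U) uniformity"

definition separated_uniform_space :: "'a::uniform_space itself \<Rightarrow> bool"
  where "separated_uniform_space (_ :: 'a itself) \<longleftrightarrow>
    \<Inter>{U :: ('a \<times> 'a) set. entourage U} = {(x, x) | x. True}"

definition E_distance :: "('a::uniform_space \<Rightarrow> 'a \<Rightarrow> real) \<Rightarrow> bool"
  where "E_distance p \<longleftrightarrow>
    (\<forall>x y. 0 \<le> p x y) \<and>
    (\<forall>U. entourage U \<longrightarrow>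
      (\<exists>\<delta>>0. \<forall>x y z. p z x \<le> \<delta> \<and> p z y \<le> \<delta> \<longrightarrow> (x, y) \<in> U)) \<and>
    (\<forall>x y z. p x y \<le> p x z + p z y)"

(* As p need not be symmetric, the order of the arguments of p matters below. *)

definition p_convergent_to :: "('a \<Rightarrow> 'a \<Rightarrow> real) \<Rightarrow> (nat \<Rightarrow> 'a) \<Rightarrow> 'a \<Rightarrow> bool"
  where "p_convergent_to p X x \<longleftrightarrow> (\<lambda>n. p (X n) x) \<longlonglongrightarrow> 0"

(* The limit is over independent m and n, without the restriction m < n. *)
definition p_Cauchy :: "('a \<Rightarrow> 'a \<Rightarrow> real) \<Rightarrow> (nat \<Rightarrow> 'a) \<Rightarrow> bool"
  where "p_Cauchy p X \<longleftrightarrow>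
    ((\<lambda>(m, n). p (X m) (X n)) \<longlongrightarrow> 0) (sequentially \<times>\<^sub>F sequentially)"

definition p_complete :: "('a \<Rightarrow> 'a \<Rightarrow> real) \<Rightarrow> bool"
  where "p_complete p \<longleftrightarrow> (\<forall>X. p_Cauchy p X \<longrightarrow> (\<exists>x. p_convergent_to p X x))"

(* Maps from [0,\<infinity>) to itself are represented by functions on all reals; values at
   negative arguments are unconstrained.  The limsup is taken in the extended reals,
   since limsup over the reals is meaningful only for bounded sequences. *)

definition right_upper_semicontinuous :: "(real \<Rightarrow> real) \<Rightarrow> bool"
  where "right_upper_semicontinuous \<psi> \<longleftrightarrow>
    (\<forall>t (s :: nat \<Rightarrow> real). 0 \<le> t \<and> decseq s \<and> s \<longlonglongrightarrow> t \<longrightarrow>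
      limsup (\<lambda>n. ereal (\<psi> (s n))) \<le> ereal (\<psi> t))"

definition Psi_class :: "(real \<Rightarrow> real) set"
  where "Psi_class = {\<psi>. (\<forall>t\<ge>0. 0 \<le> \<psi> t) \<and> right_upper_semicontinuous \<psi> \<and>
    (\<forall>t>0. \<psi> t < t) \<and> \<psi> 0 = 0}"

end

theory Submission
  imports Defs
begin

text \<open>
  The comparison function \<open>\<psi>\<close> matters only through the condition of Meir and Keeler: for
  every \<open>\<epsilon> > 0\<close> there is a \<open>\<delta> > 0\<close> such that \<open>p x y < \<epsilon> + \<delta>\<close> forces \<open>p (T x) (T y) < \<epsilon>\<close>.
  Semicontinuity from the right provides it (\<open>Psi_class_imp_Meir_Keeler\<close>): since \<open>\<psi> \<epsilon> < \<epsilon>\<close>,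
  the values of \<open>\<psi>\<close> stay below \<open>\<epsilon>\<close> a little to the right of \<open>\<epsilon>\<close>, while to the left
  \<open>\<psi> t \<le> t < \<epsilon>\<close>.

  The condition makes any two orbits asymptotic (\<open>Meir_Keeler_orbits_asymptotic\<close>): the distances
  \<open>p (T\<^sup>n x) (T\<^sup>n y)\<close> decrease, and they cannot stall at a positive limit \<open>\<epsilon>\<close>, because once
  they are below \<open>\<epsilon> + \<delta>\<close> the next one is below \<open>\<epsilon>\<close>.  It also traps an orbit
  (\<open>Meir_Keeler_orbit_tail\<close>): if consecutive points are at distance below \<open>\<delta>\<close>, then a point within
  \<open>\<epsilon> + \<delta>\<close> of the \<open>n\<close>-th one is followed by another such point.  As the assumptions on \<open>p\<close> used
  here survive the exchange of its arguments, this gives both halves of the Cauchy property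
  although \<open>p\<close> is not symmetric.

  Completeness yields a \<open>p\<close>-limit \<open>u\<close> of an orbit.  The orbit also \<open>p\<close>-converges to \<open>T u\<close>, and
  in a separated space \<open>p\<close>-limits are unique (\<open>p_limit_unique\<close>), so \<open>T u = u\<close>.  Comparing the
  orbit of an arbitrary point with the constant orbit of \<open>u\<close> gives both the convergence of all
  orbits to \<open>u\<close> and the uniqueness of \<open>u\<close>.
\<close>

definition Meir_Keeler :: "('a \<Rightarrow> 'a \<Rightarrow> real) \<Rightarrow> ('a \<Rightarrow> 'a) \<Rightarrow> bool"
  where "Meir_Keeler p T \<longleftrightarrow>
    (\<forall>\<epsilon>>0. \<exists>\<delta>>0. \<forall>x y. p x y < \<epsilon> + \<delta> \<longrightarrow> p (T x) (T y) < \<epsilon>)"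

lemma Meir_KeelerE:
  assumes "Meir_Keeler p T" and "0 < \<epsilon>"
  obtains \<delta> where "0 < \<delta>" and "\<And>x y. p x y < \<epsilon> + \<delta> \<Longrightarrow> p (T x) (T y) < \<epsilon>"
  using assms unfolding Meir_Keeler_def by blast

lemma Meir_Keeler_swap:
  "Meir_Keeler p T \<Longrightarrow> Meir_Keeler (\<lambda>x y. p y x) T"
  unfolding Meir_Keeler_def by blast

text \<open>
  A sequence decreasing to \<open>\<epsilon>\<close> along which \<open>\<psi>\<close> is at least \<open>\<epsilon>\<close> would have upper limit at
  least \<open>\<epsilon> > \<psi> \<epsilon>\<close>.
\<close>

lemma Psi_class_eventually_less:
  assumes "\<psi> \<in> Psi_class" and "0 < \<epsilon>"
  shows "eventually (\<lambda>t. \<psi> t < \<epsilon>) (at_right \<epsilon>)"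
proof (rule sequentially_imp_eventually_at_right[of \<epsilon> "\<epsilon> + 1"])
  fix s :: "nat \<Rightarrow> real"
  assume s: "decseq s" "s \<longlonglongrightarrow> \<epsilon>"
  have "limsup (\<lambda>n. ereal (\<psi> (s n))) \<le> ereal (\<psi> \<epsilon>)"
    using assms s unfolding Psi_class_def right_upper_semicontinuous_def by simp
  also have "\<dots> < ereal \<epsilon>"
    using assms unfolding Psi_class_def by simp
  finally show "eventually (\<lambda>n. \<psi> (s n) < \<epsilon>) sequentially"
    using Limsup_lessD by fastforce
qed simp

lemma Psi_class_imp_Meir_Keeler:
  assumes \<psi>: "\<psi> \<in> Psi_class"
    and nonneg: "\<And>x y. 0 \<le> p x y"
    and contr: "\<And>x y. p (T x) (T y) \<le> \<psi> (p x y)"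
  shows "Meir_Keeler p T"
  unfolding Meir_Keeler_def
proof (intro allI impI)
  fix \<epsilon> :: real
  assume \<epsilon>: "0 < \<epsilon>"
  obtain b where b: "b > \<epsilon>" and right: "\<And>t. \<epsilon> < t \<Longrightarrow> t < b \<Longrightarrow> \<psi> t < \<epsilon>"
    using Psi_class_eventually_less[OF \<psi> \<epsilon>] unfolding eventually_at_right_field by blast
  have "\<psi> t < \<epsilon>" if "0 \<le> t" "t < b" for t
  proof (cases "\<epsilon> < t")
    case True
    then show ?thesis using right that by simp
  next
    case False
    moreover have "\<psi> 0 = 0" "0 < t \<Longrightarrow> \<psi> t < t"
      using \<psi> unfolding Psi_class_def by auto
    ultimately show ?thesis
      using \<open>0 \<le> t\<close> \<epsilon> by (cases "t = 0") auto
  qed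
  then have "p (T x) (T y) < \<epsilon>" if "p x y < \<epsilon> + (b - \<epsilon>)" for x y
    using that nonneg[of x y] contr[of x y] by fastforce
  then show "\<exists>\<delta>>0. \<forall>x y. p x y < \<epsilon> + \<delta> \<longrightarrow> p (T x) (T y) < \<epsilon>"
    using b by (intro exI[of _ "b - \<epsilon>"]) simp
qed

lemma Meir_Keeler_nonexpansive:
  assumes "Meir_Keeler p T" and nonneg: "\<And>x y. 0 \<le> p x y"
  shows "p (T x) (T y) \<le> p x y"
proof (rule dense_ge)
  fix \<epsilon>
  assume \<epsilon>: "p x y < \<epsilon>"
  then have "0 < \<epsilon>" using nonneg[of x y] by linarith
  then obtain \<delta> where "0 < \<delta>" "\<And>x y. p x y < \<epsilon> + \<delta> \<Longrightarrow> p (T x) (T y) < \<epsilon>"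
    using Meir_KeelerE[OF assms(1)] by metis
  then show "p (T x) (T y) \<le> \<epsilon>"
    using \<epsilon> by (simp add: less_imp_le)
qed

lemma Meir_Keeler_orbits_asymptotic:
  assumes MK: "Meir_Keeler p T" and nonneg: "\<And>x y. 0 \<le> p x y"
  shows "(\<lambda>n. p ((T ^^ n) x) ((T ^^ n) y)) \<longlonglongrightarrow> 0"
proof -
  define a where "a n = p ((T ^^ n) x) ((T ^^ n) y)" for n
  have dec: "decseq a"
    using Meir_Keeler_nonexpansive[OF MK nonneg] unfolding a_def by (intro decseq_SucI) simp
  moreover have a_nonneg: "\<And>n. 0 \<le> a n"
    using nonneg by (simp add: a_def)
  ultimately obtain r where r: "a \<longlonglongrightarrow> r" and r_le: "\<And>n. r \<le> a n"
    using decseq_convergent by blast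
  have "0 \<le> r"
    using r a_nonneg LIMSEQ_le_const by blast
  moreover have "\<not> 0 < r"
  proof
    assume "0 < r"
    then obtain \<delta> where \<delta>: "0 < \<delta>" and step: "\<And>x y. p x y < r + \<delta> \<Longrightarrow> p (T x) (T y) < r"
      using Meir_KeelerE[OF MK] by metis
    have "eventually (\<lambda>n. a n < r + \<delta>) sequentially"
      using order_tendstoD(2)[OF r] \<delta> by simp
    then obtain n where "a n < r + \<delta>"
      unfolding eventually_sequentially by blast
    then have "a (Suc n) < r"
      using step unfolding a_def by simp
    then show False
      using r_le[of "Suc n"] by linarith
  qed
  ultimately have "r = 0" by linarith
  with r show ?thesis by (simp add: a_def[abs_def])
qed

text \<open>
  The gain of \<open>\<delta>\<close> in the Meir--Keeler condition pays for one step of the orbit: \<open>T\<close> maps two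
  points at distance below \<open>\<epsilon> + \<delta>\<close> to points at distance below \<open>\<epsilon>\<close>, and the step from
  \<open>T\<^sup>n x\<close> to \<open>T\<^sup>n\<^sup>+\<^sup>1 x\<close> costs less than \<open>\<delta>\<close>.  The induction on \<open>m\<close> has to start at the
  distance from a point of the orbit to itself, which need not be \<open>0\<close> but tends to \<open>0\<close> along
  the orbit.
\<close>

lemma Meir_Keeler_orbit_tail:
  assumes MK: "Meir_Keeler p T"
    and nonneg: "\<And>x y. 0 \<le> p x y"
    and triangle: "\<And>x y z. p x y \<le> p x z + p z y"
    and e: "0 < e"
  shows "\<exists>N. \<forall>n\<ge>N. \<forall>m\<ge>n. p ((T ^^ n) x) ((T ^^ m) x) < e"
proof -
  let ?x = "\<lambda>n. (T ^^ n) x"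
  obtain \<delta>' where \<delta>': "0 < \<delta>'"
    and gain': "\<And>x y. p x y < e / 2 + \<delta>' \<Longrightarrow> p (T x) (T y) < e / 2"
    using Meir_KeelerE[OF MK, of "e / 2"] e by (metis half_gt_zero)
  define \<delta> where "\<delta> = min \<delta>' (e / 2)"
  have \<delta>: "0 < \<delta>" "\<delta> \<le> e / 2"
    using \<delta>' e by (auto simp: \<delta>_def)
  have gain: "\<And>x y. p x y < e / 2 + \<delta> \<Longrightarrow> p (T x) (T y) < e / 2"
    using gain' by (simp add: \<delta>_def)
  have "(\<lambda>n. p (?x n) (?x n)) \<longlonglongrightarrow> 0"
    by (rule Meir_Keeler_orbits_asymptotic[OF MK nonneg])
  moreover have "(\<lambda>n. p (?x n) (?x (Suc n))) \<longlonglongrightarrow> 0"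
    using Meir_Keeler_orbits_asymptotic[OF MK nonneg, of x "T x"] by (simp add: funpow_swap1)
  ultimately have
    "eventually (\<lambda>n. p (?x n) (?x n) < \<delta> \<and> p (?x n) (?x (Suc n)) < \<delta>) sequentially"
    using \<delta>(1) by (intro eventually_conj order_tendstoD(2))
  then obtain N where N: "\<And>n. N \<le> n \<Longrightarrow> p (?x n) (?x n) < \<delta> \<and> p (?x n) (?x (Suc n)) < \<delta>"
    unfolding eventually_sequentially by blast
  have "p (?x n) (?x m) < e / 2 + \<delta>" if "N \<le> n" "n \<le> m" for n m
    using that(2)
  proof (induction m rule: dec_induct)
    case base
    then show ?case using N[OF that(1)] e by linarith
  next
    case (step m)
    have "p (?x n) (?x (Suc m)) \<le> p (?x n) (?x (Suc n)) + p (?x (Suc n)) (?x (Suc m))"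
      by (rule triangle)
    moreover have "p (?x (Suc n)) (?x (Suc m)) < e / 2"
      using gain[OF step.IH] by simp
    ultimately show ?case using N[OF that(1)] by linarith
  qed
  then show ?thesis using \<delta>(2) by fastforce
qed

lemma p_CauchyI:
  assumes nonneg: "\<And>x y. 0 \<le> p x y"
    and small: "\<And>e. 0 < e \<Longrightarrow> \<exists>N. \<forall>m\<ge>N. \<forall>n\<ge>N. p (X m) (X n) < e"
  shows "p_Cauchy p X"
  unfolding p_Cauchy_def tendsto_iff
proof (intro allI impI)
  fix e :: real
  assume "0 < e"
  then obtain N where "\<forall>m\<ge>N. \<forall>n\<ge>N. p (X m) (X n) < e"
    using small by blast
  then have "eventually (\<lambda>(m, n). p (X m) (X n) < e) (sequentially \<times>\<^sub>F sequentially)"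
    unfolding eventually_prod_sequentially by auto
  then show "eventually (\<lambda>z. dist (case z of (m, n) \<Rightarrow> p (X m) (X n)) 0 < e)
      (sequentially \<times>\<^sub>F sequentially)"
    by eventually_elim (auto simp: nonneg)
qed

lemma Meir_Keeler_orbit_Cauchy:
  assumes MK: "Meir_Keeler p T"
    and nonneg: "\<And>x y. 0 \<le> p x y"
    and triangle: "\<And>x y z. p x y \<le> p x z + p z y"
  shows "p_Cauchy p (\<lambda>n. (T ^^ n) x)"
proof (rule p_CauchyI[OF nonneg])
  fix e :: real
  assume e: "0 < e"
  obtain N where N: "\<And>m n. N \<le> n \<Longrightarrow> n \<le> m \<Longrightarrow> p ((T ^^ n) x) ((T ^^ m) x) < e"
    using Meir_Keeler_orbit_tail[OF MK nonneg triangle e] by blast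
  have "\<And>x y z. p y x \<le> p z x + p y z"
    using triangle by (metis add.commute)
  then obtain N' where N': "\<And>m n. N' \<le> n \<Longrightarrow> n \<le> m \<Longrightarrow> p ((T ^^ m) x) ((T ^^ n) x) < e"
    using Meir_Keeler_orbit_tail[OF Meir_Keeler_swap[OF MK] nonneg _ e] by blast
  have "p ((T ^^ m) x) ((T ^^ n) x) < e" if "max N N' \<le> m" "max N N' \<le> n" for m n
    using N[of m n] N'[of n m] that by (cases "m \<le> n") auto
  then show "\<exists>N. \<forall>m\<ge>N. \<forall>n\<ge>N. p ((T ^^ m) x) ((T ^^ n) x) < e"
    by blast
qed

text \<open>
  A late term of the sequence is \<open>p\<close>-close to both limits, and so witnesses that the pair of
  limits lies in a prescribed entourage.
\<close>

lemma p_limit_unique: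
  fixes u v :: "'a::uniform_space"
  assumes sep: "separated_uniform_space TYPE('a)"
    and E: "E_distance p"
    and u: "p_convergent_to p X u" and v: "p_convergent_to p X v"
  shows "u = v"
proof -
  have "(u, v) \<in> U" if "entourage U" for U
  proof -
    obtain \<delta> where \<delta>: "0 < \<delta>" "\<And>x y z. p z x \<le> \<delta> \<Longrightarrow> p z y \<le> \<delta> \<Longrightarrow> (x, y) \<in> U"
      using E \<open>entourage U\<close> unfolding E_distance_def by meson
    have "eventually (\<lambda>n. p (X n) u < \<delta> \<and> p (X n) v < \<delta>) sequentially"
      using u v \<delta>(1) unfolding p_convergent_to_def
      by (intro eventually_conj order_tendstoD(2))
    then obtain n where "p (X n) u < \<delta>" "p (X n) v < \<delta>"
      unfolding eventually_sequentially by blast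
    then show ?thesis using \<delta>(2)[of "X n"] by simp
  qed
  then have "(u, v) \<in> \<Inter>{U. entourage U}" by blast
  then show ?thesis using sep unfolding separated_uniform_space_def by simp
qed

theorem theorem2:
  fixes p :: "'a::uniform_space \<Rightarrow> 'a \<Rightarrow> real"
    and T :: "'a \<Rightarrow> 'a"
    and \<psi> :: "real \<Rightarrow> real"
  assumes "separated_uniform_space TYPE('a)"
    and "E_distance p"
    and "p_complete p"
    and "\<psi> \<in> Psi_class"
    and "\<And>x y. p (T x) (T y) \<le> \<psi> (p x y)"
  shows "\<exists>u. T u = u \<and> (\<forall>v. T v = v \<longrightarrow> v = u) \<and>
    (\<forall>x. p_convergent_to p (\<lambda>n. (T ^^ n) x) u)"
proof -
  have nonneg: "\<And>x y. 0 \<le> p x y" and triangle: "\<And>x y z. p x y \<le> p x z + p z y"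
    using assms(2) unfolding E_distance_def by blast+
  have MK: "Meir_Keeler p T"
    using assms(4) nonneg assms(5) by (rule Psi_class_imp_Meir_Keeler)
  \<comment> \<open>The orbit of an arbitrary point serves to find the limit.\<close>
  define X where "X n = (T ^^ n) undefined" for n
  have "p_Cauchy p X"
    unfolding X_def by (rule Meir_Keeler_orbit_Cauchy[OF MK nonneg triangle])
  then obtain u where u: "p_convergent_to p X u"
    using assms(3) unfolding p_complete_def by blast
  have fixed: "T u = u"
  proof (rule p_limit_unique[OF assms(1,2)])
    show "p_convergent_to p (\<lambda>n. X (Suc n)) u"
      using u unfolding p_convergent_to_def by (rule LIMSEQ_Suc)
    have le: "p (X (Suc n)) (T u) \<le> p (X n) u" for n
      using Meir_Keeler_nonexpansive[OF MK nonneg] by (simp add: X_def)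
    show "p_convergent_to p (\<lambda>n. X (Suc n)) (T u)"
      unfolding p_convergent_to_def
    proof (rule tendsto_sandwich)
      show "eventually (\<lambda>n. 0 \<le> p (X (Suc n)) (T u)) sequentially"
        using nonneg by simp
      show "eventually (\<lambda>n. p (X (Suc n)) (T u) \<le> p (X n) u) sequentially"
        using le by simp
      show "(\<lambda>n. p (X n) u) \<longlonglongrightarrow> 0"
        using u unfolding p_convergent_to_def .
    qed simp
  qed
  have fixed_funpow: "(T ^^ n) v = v" if "T v = v" for v n
    using that by (induction n) auto
  have conv: "p_convergent_to p (\<lambda>n. (T ^^ n) x) u" for x
    using Meir_Keeler_orbits_asymptotic[OF MK nonneg, of x u]
    unfolding p_convergent_to_def by (simp add: fixed_funpow[OF fixed])
  have "v = u" if "T v = v" for v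
  proof (rule p_limit_unique[OF assms(1,2)])
    \<comment> \<open>The constant orbit of \<open>v\<close> converges to \<open>v\<close>: although \<open>p v v = 0\<close> is not part of the
      definition of an \<open>E\<close>-distance, it holds at fixed points.\<close>
    show "p_convergent_to p (\<lambda>n. (T ^^ n) v) v"
      using Meir_Keeler_orbits_asymptotic[OF MK nonneg, of v v]
      unfolding p_convergent_to_def by (simp add: fixed_funpow[OF that])
  qed (rule conv)
  with fixed conv show ?thesis by blast
qed

end
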